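(* For every integer $n\geq 2$ and every symmetric convex body $K\subset\mathbb{R}^n$ there exists $U\in \mathrm{SO}(n)$ such that the inclusion $$Q_{k-1}(UK)\subseteq 3\,Q_k(UK)$$ holds for every $k\in\{2,\dots,n\}$.
   Context: A convex body in $\mathbb{R}^n$ is a compact convex subset of $\mathbb{R}^n$ with nonempty interior; it is symmetric if $K=-K$. Let $\{e_1,\dots,e_n\}$ be the standard basis of $\mathbb{R}^n$. For $S\subseteq\{1,\dots,n\}$ let $P_S:\mathbb{R}^n\to\mathbb{R}^n$ be the orthogonal projection onto the subspace spanned by $\{e_j : j\in S\}$. For $k\in\{1,\dots,n\}$ let $[n]_k$ be the family of all subsets $S\subseteq\{1,\dots,n\}$ of cardinality $k$. For a convex body $K\subset\mathbb{R}^n$ and $k\in\{1,\dots,n\}$, the $k$-convex hull of $K$ is $$Q_k(K)=\bigcap_{S\in[n]_k}P_S^{-1}\bigl(P_S(K)\bigr).$$ Here $P_S^{-1}$ denotes preimage, $UK=\{Ux: x\in K\}$, and $3A=\{3a: a\in A\}$. *)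

theory Defs
  imports "HOL-Analysis.Analysis"
begin

definition convex_body :: "'a::euclidean_space set \<Rightarrow> bool" where
  "convex_body K \<longleftrightarrow> compact K \<and> convex K \<and> interior K \<noteq> {}"

definition symmetric_set :: "'a::real_vector set \<Rightarrow> bool" where
  "symmetric_set K \<longleftrightarrow> K = uminus ` K"

(* Intended for subspaces V, where the point y exists and is unique. *)
definition orth_proj :: "'a::euclidean_space set \<Rightarrow> 'a \<Rightarrow> 'a" where
  "orth_proj V x = (THE y. y \<in> V \<and> x - y \<in> orthogonal_comp V)"

(* The finite type 'n is the index set {1,...,n}, with n = CARD('n). *)
definition coord_proj :: "'n set \<Rightarrow> real ^ 'n \<Rightarrow> real ^ 'n" where
  "coord_proj S = orth_proj (span {axis j 1 | j. j \<in> S})"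

definition k_convex_hull :: "nat \<Rightarrow> (real ^ 'n) set \<Rightarrow> (real ^ 'n) set" where
  "k_convex_hull k K = (\<Inter>S\<in>{S. card S = k}. coord_proj S -` (coord_proj S ` K))"

lemma orth_proj_eqI:
  assumes "subspace V" "y \<in> V" "x - y \<in> orthogonal_comp V"
  shows "orth_proj V x = y"
  unfolding orth_proj_def
proof (rule the_equality)
  fix z assume z: "z \<in> V \<and> x - z \<in> orthogonal_comp V"
  have 1: "y - z \<in> V"
    using assms z by (simp add: subspace_diff)
  have "(x - z) - (x - y) \<in> orthogonal_comp V"
    using assms z subspace_diff[OF subspace_orthogonal_comp] by blast
  then have "orthogonal (y - z) (y - z)"
    using 1 by (simp add: orthogonal_comp_def)
  then show "z = y"
    by (simp add: orthogonal_def)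
qed (use assms in auto)

lemma coord_proj_eq: "coord_proj S x = (\<chi> i. if i \<in> S then x $ i else 0)"
  unfolding coord_proj_def
proof (rule orth_proj_eqI)
  let ?B = "{axis j (1::real) | j. j \<in> S}"
  let ?y = "\<chi> i. if i \<in> S then x $ i else 0"
  have "?y = (\<Sum>j\<in>S. x $ j *\<^sub>R axis j 1)"
    by (simp add: vec_eq_iff axis_def if_distrib sum.If_cases cong: if_cong)
  also have "\<dots> \<in> span ?B"
    by (intro span_sum span_scale span_base) auto
  finally show "?y \<in> span ?B" .
  have "orthogonal (x - ?y) v" if "v \<in> span ?B" for v
    using that
    by (rule orthogonal_to_span) (auto simp: orthogonal_def inner_axis)
  then show "x - ?y \<in> orthogonal_comp (span ?B)"
    by (simp add: orthogonal_comp_def orthogonal_commute)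
qed simp

end

theory Submission
  imports Defs
begin

text \<open>
  The rotation \<open>U\<close> is found greedily. Choose a unit vector \<open>u\<^sub>1\<close> and a point \<open>p\<^sub>1\<close> of \<open>K\<close> that
  maximise \<open>u \<bullet> y\<close>, then do the same among the unit vectors \<open>u\<^sub>2\<close> orthogonal to \<open>u\<^sub>1\<close>, and so on.
  Maximality in \<open>u\<^sub>i\<close> forces \<open>p\<^sub>i\<close> to be orthogonal to every later vector: otherwise tilting \<open>u\<^sub>i\<close>
  towards such a vector would increase the inner product with \<open>p\<^sub>i\<close> (\<open>ex_maximal_direction\<close>).
  Up to one change of sign, the \<open>u\<^sub>i\<close> are the rows of a rotation. In the rotated body \<open>L\<close>, the
  point \<open>p\<^sub>i\<close> has the largest \<open>i\<close>th coordinate \<open>r\<close> that occurs in \<open>L\<close>, and its coordinates after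
  the \<open>i\<close>th vanish.

  Now let \<open>x\<close> lie in the \<open>(k - 1)\<close>-convex hull of \<open>L\<close> and let \<open>S\<close> be a set of \<open>k\<close> coordinates, with
  first element \<open>i\<close>. Seen from \<open>S\<close>, the point \<open>p\<^sub>i\<close> is \<open>r\<close> times the \<open>i\<close>th basis vector. Some \<open>y\<close>
  in \<open>L\<close> agrees with \<open>x\<close> on \<open>S - {i}\<close>. Both \<open>\<bar>x\<^sub>i\<bar>\<close> and \<open>\<bar>y\<^sub>i\<bar>\<close> are at most \<open>r\<close>; for \<open>x\<close> this holds
  because \<open>k - 1 \<ge> 1\<close>, so that some \<open>k - 1\<close> elements of \<open>S\<close> include \<open>i\<close>. Hence on \<open>S\<close> the point \<open>x\<close>
  equals \<open>y + t p\<^sub>i\<close> with \<open>\<bar>t\<bar> \<le> 2\<close>, which lies in \<open>L + 2L = 3L\<close> by symmetry and convexity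
  (\<open>k_convex_hull_pred_subset\<close>).
\<close>

text \<open>
  One greedy step: the new direction is sought orthogonal to the set \<open>B\<close> of vectors chosen so far.
  The last clause of the conclusion is the first-order condition for the maximum in \<open>u\<close>.
\<close>

lemma ex_maximal_direction:
  fixes K B :: "'a::euclidean_space set"
  assumes "compact K" "K \<noteq> {}" "symmetric_set K" and dim: "dim B < DIM('a)"
  shows "\<exists>u. norm u = 1 \<and> (\<forall>b\<in>B. u \<bullet> b = 0) \<and>
    (\<exists>x\<in>K. (\<forall>y\<in>K. \<bar>u \<bullet> y\<bar> \<le> u \<bullet> x) \<and>
      (\<forall>v. v \<bullet> u = 0 \<and> (\<forall>b\<in>B. v \<bullet> b = 0) \<longrightarrow> v \<bullet> x = 0))"
proof -
  define C where "C = sphere 0 1 \<inter> (\<Inter>b\<in>B. {u. u \<bullet> b = 0})"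
  have C_iff: "u \<in> C \<longleftrightarrow> norm u = 1 \<and> (\<forall>b\<in>B. u \<bullet> b = 0)" for u
    by (auto simp: C_def)
  have "closed {u. u \<bullet> b = 0}" for b :: 'a
    by (intro closed_Collect_eq continuous_intros)
  then have "compact C"
    unfolding C_def by (intro compact_Int_closed compact_sphere closed_INT) auto
  have normalize: "(1 / norm w) *\<^sub>R w \<in> C" if "w \<noteq> 0" "\<forall>b\<in>B. w \<bullet> b = 0" for w
    using that by (auto simp: C_iff)
  obtain w where "w \<noteq> 0" "\<And>y. y \<in> span B \<Longrightarrow> orthogonal w y"
    using orthogonal_to_subspace_exists[OF dim] by blast
  then have "C \<noteq> {}"
    using normalize[of w] by (auto simp: orthogonal_def span_base)
  have "continuous_on (C \<times> K) (\<lambda>z. fst z \<bullet> snd z)"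
    by (intro continuous_intros)
  moreover have "compact (C \<times> K)" "C \<times> K \<noteq> {}"
    using \<open>compact C\<close> \<open>C \<noteq> {}\<close> assms by (auto intro: compact_Times)
  ultimately obtain u x where u: "u \<in> C" and x: "x \<in> K"
    and max: "\<And>v y. v \<in> C \<Longrightarrow> y \<in> K \<Longrightarrow> v \<bullet> y \<le> u \<bullet> x"
    using continuous_attains_sup[of "C \<times> K" "\<lambda>z. fst z \<bullet> snd z"] by fastforce
  have "\<bar>u \<bullet> y\<bar> \<le> u \<bullet> x" if "y \<in> K" for y
  proof -
    have "- y \<in> K"
      using that \<open>symmetric_set K\<close> unfolding symmetric_set_def by blast
    then show ?thesis
      using max[OF u that] max[OF u, of "- y"] by auto
  qed
  moreover have "v \<bullet> x = 0" if v: "v \<bullet> u = 0" "\<forall>b\<in>B. v \<bullet> b = 0" for v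
  proof (rule ccontr)
    assume nz: "v \<bullet> x \<noteq> 0"
    then have "v \<noteq> 0" by auto
    define e where "e = (1 / norm v) *\<^sub>R v"
    have e: "e \<in> C" "e \<bullet> u = 0" "e \<bullet> x \<noteq> 0"
      using normalize[OF \<open>v \<noteq> 0\<close>] v nz \<open>v \<noteq> 0\<close> by (auto simp: e_def)
    \<comment> \<open>The projection of \<open>x\<close> to the plane of \<open>u\<close> and \<open>e\<close> points in a better direction than \<open>u\<close>.\<close>
    define q where "q = (u \<bullet> x) *\<^sub>R u + (e \<bullet> x) *\<^sub>R e"
    have q_x: "q \<bullet> x = (u \<bullet> x)\<^sup>2 + (e \<bullet> x)\<^sup>2"
      by (simp add: q_def inner_add_left power2_eq_square)
    have "u \<bullet> u = 1" "e \<bullet> e = 1" "u \<bullet> e = 0"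
      using u e by (auto simp: C_iff norm_eq_1 inner_commute)
    then have q_q: "q \<bullet> q = (u \<bullet> x)\<^sup>2 + (e \<bullet> x)\<^sup>2"
      using e(2) by (simp add: q_def inner_add_left inner_add_right power2_eq_square)
    then have "(norm q)\<^sup>2 > (u \<bullet> x)\<^sup>2"
      using e(3) by (simp add: power2_norm_eq_inner)
    then have less: "norm q > u \<bullet> x"
      by (rule power_less_imp_less_base) simp
    have "q \<noteq> 0"
      using q_q e(3) by (auto simp: sum_power2_eq_zero_iff)
    moreover have "\<forall>b\<in>B. q \<bullet> b = 0"
      using u e(1) by (simp add: C_iff q_def inner_add_left)
    ultimately have "(1 / norm q) *\<^sub>R q \<bullet> x \<le> u \<bullet> x"
      using max[OF normalize x] by blast
    moreover have "(1 / norm q) *\<^sub>R q \<bullet> x = norm q"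
    proof -
      have "q \<bullet> x = norm q * norm q"
        using q_x q_q by (simp add: power2_norm_eq_inner[symmetric] power2_eq_square)
      then show ?thesis
        using \<open>q \<noteq> 0\<close> by simp
    qed
    ultimately show False
      using less by simp
  qed
  ultimately show ?thesis
    using u x unfolding C_iff by blast
qed

text \<open>
  The last clause says that \<open>x\<close> lies in the span of \<open>u 0, \<dots>, u i\<close>. Stated by duality, it can be
  applied at once to the vectors chosen after \<open>u i\<close>.
\<close>

lemma ex_greedy_orthonormal_sequence:
  fixes K :: "'a::euclidean_space set"
  assumes "compact K" "K \<noteq> {}" "symmetric_set K" and "m \<le> DIM('a)"
  shows "\<exists>u :: nat \<Rightarrow> 'a. (\<forall>i<m. norm (u i) = 1) \<and> (\<forall>i<m. \<forall>j<i. u i \<bullet> u j = 0) \<and>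
    (\<forall>i<m. \<exists>x\<in>K. (\<forall>y\<in>K. \<bar>u i \<bullet> y\<bar> \<le> u i \<bullet> x) \<and>
      (\<forall>v. (\<forall>j\<le>i. v \<bullet> u j = 0) \<longrightarrow> v \<bullet> x = 0))"
  using \<open>m \<le> DIM('a)\<close>
proof (induction m)
  case 0
  then show ?case by simp
next
  case (Suc m)
  then obtain u :: "nat \<Rightarrow> 'a" where norm: "\<forall>i<m. norm (u i) = 1"
    and orth: "\<forall>i<m. \<forall>j<i. u i \<bullet> u j = 0"
    and ext: "\<forall>i<m. \<exists>x\<in>K. (\<forall>y\<in>K. \<bar>u i \<bullet> y\<bar> \<le> u i \<bullet> x) \<and>
      (\<forall>v. (\<forall>j\<le>i. v \<bullet> u j = 0) \<longrightarrow> v \<bullet> x = 0)"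
    by auto
  have "dim (u ` {..<m}) \<le> card {..<m}"
    by (meson dim_le_card' card_image_le finite_imageI finite_lessThan le_trans)
  then have "dim (u ` {..<m}) < DIM('a)"
    using Suc.prems by simp
  from ex_maximal_direction[OF assms(1-3) this] obtain w x where
    w: "norm w = 1" "\<forall>j<m. w \<bullet> u j = 0" and x: "x \<in> K" "\<forall>y\<in>K. \<bar>w \<bullet> y\<bar> \<le> w \<bullet> x"
    "\<And>v. v \<bullet> w = 0 \<Longrightarrow> \<forall>j<m. v \<bullet> u j = 0 \<Longrightarrow> v \<bullet> x = 0"
    by auto
  have "\<exists>x\<in>K. (\<forall>y\<in>K. \<bar>(u(m := w)) i \<bullet> y\<bar> \<le> (u(m := w)) i \<bullet> x) \<and>
      (\<forall>v. (\<forall>j\<le>i. v \<bullet> (u(m := w)) j = 0) \<longrightarrow> v \<bullet> x = 0)" if "i < Suc m" for i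
  proof (cases "i = m")
    case True
    have "v \<bullet> x = 0" if "\<forall>j\<le>m. v \<bullet> (u(m := w)) j = 0" for v
    proof (rule x(3))
      show "v \<bullet> w = 0"
        using that by auto
      show "\<forall>j<m. v \<bullet> u j = 0"
        using that by (metis fun_upd_other less_imp_le nat_neq_iff)
    qed
    then show ?thesis
      using True x(1,2) by auto
  next
    case False
    then have "i < m" "\<And>j. j \<le> i \<Longrightarrow> (u(m := w)) j = u j"
      using that by auto
    then show ?thesis
      using ext by auto
  qed
  moreover have "\<forall>i<Suc m. \<forall>j<i. (u(m := w)) i \<bullet> (u(m := w)) j = 0"
    using orth w(2) by (auto simp: less_Suc_eq)
  moreover have "\<forall>i<Suc m. norm ((u(m := w)) i) = 1"
    using norm w(1) by (auto simp: less_Suc_eq)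
  ultimately show ?case
    by blast
qed

text \<open>
  Negating a row of a matrix keeps all the properties of the greedy frame, because the body is
  symmetric, and it corrects the determinant. The function \<open>f\<close> records the order in which
  the coordinates were chosen.
\<close>

lemma ex_greedy_rotation:
  fixes K :: "(real ^ 'n) set"
  assumes "compact K" "K \<noteq> {}" "symmetric_set K"
  shows "\<exists>(U :: real ^ 'n ^ 'n) (f :: 'n \<Rightarrow> nat). rotation_matrix U \<and> inj f \<and>
    (\<forall>i. \<exists>p\<in>(\<lambda>x. U *v x) ` K. (\<forall>y\<in>(\<lambda>x. U *v x) ` K. \<bar>y $ i\<bar> \<le> p $ i) \<and>
      (\<forall>j. f i < f j \<longrightarrow> p $ j = 0))"
proof -
  obtain u :: "nat \<Rightarrow> real ^ 'n" where norm: "\<And>i. i < CARD('n) \<Longrightarrow> norm (u i) = 1"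
    and orth: "\<And>i j. i < CARD('n) \<Longrightarrow> j < i \<Longrightarrow> u i \<bullet> u j = 0"
    and ext: "\<And>i. i < CARD('n) \<Longrightarrow> \<exists>x\<in>K. (\<forall>y\<in>K. \<bar>u i \<bullet> y\<bar> \<le> u i \<bullet> x) \<and>
      (\<forall>v. (\<forall>j\<le>i. v \<bullet> u j = 0) \<longrightarrow> v \<bullet> x = 0)"
    using ex_greedy_orthonormal_sequence[OF assms, of "CARD('n)"] by auto
  obtain f :: "'n \<Rightarrow> nat" where f: "bij_betw f UNIV {0..<CARD('n)}"
    using ex_bij_betw_finite_nat[OF finite_class.finite_UNIV] by blast
  then have "inj f" and f_less: "\<And>i. f i < CARD('n)"
    by (auto simp: bij_betw_def)
  have orth': "u i \<bullet> u j = 0" if "i < CARD('n)" "j < CARD('n)" "i \<noteq> j" for i j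
    using that orth[of i j] orth[of j i] by (cases i j rule: linorder_cases) (auto simp: inner_commute)
  define A :: "real ^ 'n ^ 'n" where "A = (\<chi> i. u (f i))"
  have "orthogonal_matrix A"
    using norm orth' f_less \<open>inj f\<close>
    by (simp add: orthogonal_matrix_orthonormal_rows A_def row_def vec_lambda_eta orthogonal_def
        inj_eq)
  then have "det A = 1 \<or> det A = - 1"
    by (rule det_orthogonal_matrix)
  define k :: 'n where "k = undefined"
  define s :: "'n \<Rightarrow> real" where "s i = (if i = k then det A else 1)" for i
  have s: "s i = 1 \<or> s i = - 1" for i
    using \<open>det A = 1 \<or> det A = - 1\<close> by (auto simp: s_def)
  then have "\<bar>s i\<bar> = 1" for i
    by (metis abs_minus_cancel abs_one)
  define U :: "real ^ 'n ^ 'n" where "U = (\<chi> i. s i *\<^sub>R u (f i))"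
  have "row i U = s i *\<^sub>R u (f i)" for i
    by (simp add: U_def row_def vec_eq_iff)
  then have "orthogonal_matrix U"
    using norm orth' f_less \<open>inj f\<close> \<open>\<And>i. \<bar>s i\<bar> = 1\<close>
    by (simp add: orthogonal_matrix_orthonormal_rows orthogonal_def inj_eq)
  have "U = (\<chi> i. if i = k then det A *s u (f i) else u (f i))"
    by (simp add: U_def s_def vec_eq_iff)
  then have "det U = det A * det A"
    using det_row_mul[of k "det A" "\<lambda>i. u (f i)" "\<lambda>i. u (f i)"] by (simp add: A_def)
  then have "rotation_matrix U"
    using \<open>orthogonal_matrix U\<close> \<open>det A = 1 \<or> det A = - 1\<close> by (auto simp: rotation_matrix_def)
  have U_nth: "(U *v x) $ i = s i * (u (f i) \<bullet> x)" for x i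
    by (simp add: matrix_vector_mul_component U_def)
  have "\<exists>p\<in>(\<lambda>x. U *v x) ` K. (\<forall>y\<in>(\<lambda>x. U *v x) ` K. \<bar>y $ i\<bar> \<le> p $ i) \<and>
      (\<forall>j. f i < f j \<longrightarrow> p $ j = 0)" for i
  proof -
    obtain x where x: "x \<in> K" "\<And>y. y \<in> K \<Longrightarrow> \<bar>u (f i) \<bullet> y\<bar> \<le> u (f i) \<bullet> x"
      and van: "\<And>v. (\<forall>j\<le>f i. v \<bullet> u j = 0) \<Longrightarrow> v \<bullet> x = 0"
      using ext[OF f_less[of i]] by auto
    have "- x \<in> K"
      using x(1) \<open>symmetric_set K\<close> unfolding symmetric_set_def by blast
    then have "s i *\<^sub>R x \<in> K"
      using x(1) s[of i] by auto
    moreover have "\<bar>(U *v y) $ i\<bar> \<le> (U *v (s i *\<^sub>R x)) $ i" if "y \<in> K" for y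
      using x(2)[OF that] s[of i] by (auto simp: U_nth)
    moreover have "(U *v (s i *\<^sub>R x)) $ j = 0" if "f i < f j" for j
      using van[of "u (f j)"] that orth f_less by (simp add: U_nth)
    ultimately show ?thesis
      by blast
  qed
  then show ?thesis
    using \<open>rotation_matrix U\<close> \<open>inj f\<close> by blast
qed

lemma k_convex_hull_iff:
  "x \<in> k_convex_hull k L \<longleftrightarrow> (\<forall>S. card S = k \<longrightarrow> (\<exists>y\<in>L. \<forall>i\<in>S. x $ i = y $ i))"
proof -
  have "coord_proj S x = coord_proj S y \<longleftrightarrow> (\<forall>i\<in>S. x $ i = y $ i)" for S and y
    by (auto simp: coord_proj_eq vec_eq_iff)
  then show ?thesis
    by (auto simp: k_convex_hull_def image_iff)
qed

text \<open>
  Every set \<open>S\<close> of coordinates has a first element \<open>i\<close> in the order given by \<open>f\<close>, and there the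
  hypothesis supplies a point of \<open>L\<close> whose projection to the coordinates in \<open>S\<close> is on the \<open>i\<close>th axis,
  as far out as any point of \<open>L\<close> reaches. The factor 3 counts one copy of \<open>L\<close> for the coordinates
  other than \<open>i\<close>, and two for correcting the \<open>i\<close>th one.
\<close>

lemma k_convex_hull_pred_subset:
  fixes L :: "(real ^ 'n) set" and f :: "'n \<Rightarrow> nat"
  assumes "convex L" "symmetric_set L" "inj f" "2 \<le> k"
    and ext: "\<And>i. \<exists>p\<in>L. (\<forall>y\<in>L. \<bar>y $ i\<bar> \<le> p $ i) \<and> (\<forall>j. f i < f j \<longrightarrow> p $ j = 0)"
  shows "k_convex_hull (k - 1) L \<subseteq> (\<lambda>x. 3 *\<^sub>R x) ` k_convex_hull k L"
proof
  fix x assume x: "x \<in> k_convex_hull (k - 1) L"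
  have "(1/3) *\<^sub>R x \<in> k_convex_hull k L"
    unfolding k_convex_hull_iff
  proof (intro allI impI)
    fix S :: "'n set" assume S: "card S = k"
    then have "S \<noteq> {}"
      using \<open>2 \<le> k\<close> by auto
    then obtain i where i: "i \<in> S" "\<And>j. j \<in> S \<Longrightarrow> f i \<le> f j"
      using arg_min_if_finite[of S f] by (metis finite not_le)
    obtain p where p: "p \<in> L" "\<And>y. y \<in> L \<Longrightarrow> \<bar>y $ i\<bar> \<le> p $ i"
      "\<And>j. f i < f j \<Longrightarrow> p $ j = 0"
      using ext[of i] by blast
    have "card (S - {j}) = k - 1" if "j \<in> S" for j
      using S that by simp
    then have agree: "\<exists>y\<in>L. \<forall>l\<in>S - {j}. x $ l = y $ l" if "j \<in> S" for j
      using x that unfolding k_convex_hull_iff by blast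
    obtain y where y: "y \<in> L" "\<And>l. l \<in> S - {i} \<Longrightarrow> x $ l = y $ l"
      using agree[OF i(1)] by blast
    have "card (S - {i}) \<noteq> 0"
      using S i(1) \<open>2 \<le> k\<close> by simp
    then obtain j where "j \<in> S" "j \<noteq> i"
      by (metis card.empty Diff_iff equals0I singletonI)
    then have x_i: "\<bar>x $ i\<bar> \<le> p $ i"
      using agree[of j] i(1) p(2) by fastforce
    \<comment> \<open>If \<open>p $ i = 0\<close>, then \<open>x $ i\<close> and \<open>y $ i\<close> vanish too, and the quotient is 0 as it should be.\<close>
    define t where "t = (x $ i - y $ i) / (2 * p $ i)"
    have t: "2 * t * p $ i = x $ i - y $ i"
      using x_i p(2)[OF y(1)] by (auto simp: t_def)
    have "\<bar>t\<bar> \<le> 1"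
      using x_i p(2)[OF y(1)] by (auto simp: t_def divide_simps abs_le_iff)
    have "- p \<in> L"
      using p(1) \<open>symmetric_set L\<close> unfolding symmetric_set_def by blast
    have "((1 + t) / 2) *\<^sub>R p + ((1 - t) / 2) *\<^sub>R (- p) \<in> L"
      using \<open>\<bar>t\<bar> \<le> 1\<close> by (intro convexD[OF \<open>convex L\<close> p(1) \<open>- p \<in> L\<close>]) (auto simp: field_simps)
    moreover have "((1 + t) / 2) *\<^sub>R p + ((1 - t) / 2) *\<^sub>R (- p) = t *\<^sub>R p"
      by (simp add: vec_eq_iff field_simps)
    ultimately have "t *\<^sub>R p \<in> L"
      by simp
    then have "(1/3) *\<^sub>R y + (2/3) *\<^sub>R (t *\<^sub>R p) \<in> L"
      by (intro convexD[OF \<open>convex L\<close> y(1)]) auto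
    moreover have "((1/3) *\<^sub>R x) $ l = ((1/3) *\<^sub>R y + (2/3) *\<^sub>R (t *\<^sub>R p)) $ l" if "l \<in> S" for l
    proof (cases "l = i")
      case True
      then show ?thesis
        using t by (simp add: field_simps)
    next
      case False
      then have "f i < f l"
        using i(2)[OF that] \<open>inj f\<close> by (metis injD le_neq_implies_less)
      then show ?thesis
        using p(3) y(2) that False by simp
    qed
    ultimately show "\<exists>y\<in>L. \<forall>l\<in>S. ((1/3) *\<^sub>R x) $ l = y $ l"
      by blast
  qed
  then show "x \<in> (\<lambda>x. 3 *\<^sub>R x) ` k_convex_hull k L"
    by (intro image_eqI[of _ _ "(1/3) *\<^sub>R x"]) auto
qed

theorem theorem1p2:
  fixes K :: "(real ^ 'n) set"
  assumes "CARD('n) \<ge> 2"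
    and "convex_body K"
    and "symmetric_set K"
  shows "\<exists>U :: real ^ 'n ^ 'n. rotation_matrix U \<and>
           (\<forall>k\<in>{2..CARD('n)}.
              k_convex_hull (k - 1) ((\<lambda>x. U *v x) ` K)
                \<subseteq> (\<lambda>x. 3 *\<^sub>R x) ` k_convex_hull k ((\<lambda>x. U *v x) ` K))"
proof -
  have K: "compact K" "convex K" "K \<noteq> {}"
    using \<open>convex_body K\<close> by (auto simp: convex_body_def)
  obtain U :: "real ^ 'n ^ 'n" and f :: "'n \<Rightarrow> nat" where U: "rotation_matrix U" "inj f"
    and ext: "\<And>i. \<exists>p\<in>(\<lambda>x. U *v x) ` K. (\<forall>y\<in>(\<lambda>x. U *v x) ` K. \<bar>y $ i\<bar> \<le> p $ i) \<and>
      (\<forall>j. f i < f j \<longrightarrow> p $ j = 0)"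
    using ex_greedy_rotation[OF K(1,3) \<open>symmetric_set K\<close>] by blast
  have "convex ((\<lambda>x. U *v x) ` K)"
    using K(2) by (intro convex_linear_image matrix_vector_mul_linear)
  moreover have "symmetric_set ((\<lambda>x. U *v x) ` K)"
  proof -
    have "uminus ` (\<lambda>x. U *v x) ` K = (\<lambda>x. U *v x) ` uminus ` K"
      by (simp add: image_image linear_neg[OF matrix_vector_mul_linear])
    then show ?thesis
      using \<open>symmetric_set K\<close> by (simp add: symmetric_set_def)
  qed
  ultimately have "\<forall>k\<in>{2..CARD('n)}. k_convex_hull (k - 1) ((\<lambda>x. U *v x) ` K)
      \<subseteq> (\<lambda>x. 3 *\<^sub>R x) ` k_convex_hull k ((\<lambda>x. U *v x) ` K)"
    using k_convex_hull_pred_subset[OF _ _ \<open>inj f\<close> _ ext] by (meson atLeastAtMost_iff)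
  then show ?thesis
    using U by blast
qed

end
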